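(* For the convex vector optimization problem (P) described in the context, with upper image $\mathcal{P}$ and set of weights $W$, it holds that $(\operatorname{recc}\mathcal{P})^+=\operatorname{cl}W$. Moreover, if problem (P) is self-bounded, then $(\operatorname{recc}\mathcal{P})^+=W$.
   Context: A subset $K\subseteq\mathbb{R}^q$ is a cone if $\lambda k\in K$ whenever $k\in K$ and $\lambda>0$. A convex cone is nontrivial if it is neither empty nor the whole space, and pointed if it contains no line through $0$. A nontrivial pointed convex cone $C$ defines the ordering $v\le_C w$ iff $w-v\in C$. For a convex set $X\subseteq\mathbb{R}^n$, a function $f:X\to\mathbb{R}^q$ is $C$-convex if $f(\alpha x+(1-\alpha)y)\le_C\alpha f(x)+(1-\alpha)f(y)$ for all $x,y\in X$, $\alpha\in[0,1]$. The dual cone of a cone $K\subseteq\mathbb{R}^q$ is $K^+=\{z\in\mathbb{R}^q : z^Ty\ge 0\ \forall y\in K\}$. The recession cone of a set $A$ is $\operatorname{recc}A=\{k\in\mathbb{R}^q : \forall a\in A,\ \forall\alpha\ge 0:\ a+\alpha k\in A\}$. Convex vector optimization problem (P): minimize $f(x)$ with respect to $\le_C$ subject to $g(x)\le_D 0$, where $C\subseteq\mathbb{R}^q$ and $D\subseteq\mathbb{R}^m$ are nontrivial pointed convex cones with nonempty interior, $X\subseteq\mathbb{R}^n$ is a convex set, $f:X\to\mathbb{R}^q$ is $C$-convex and $g:X\to\mathbb{R}^m$ is $D$-convex. The feasible set $\mathcal{X}:=\{x\in X : g(x)\le_D 0\}$ is assumed nonempty. The upper image is $\mathcal{P}:=\operatorname{cl}(f(\mathcal{X})+C)$.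 Problem (P) is self-bounded if $\mathcal{P}\neq\mathbb{R}^q$ and there exists $y\in\mathbb{R}^q$ with $\mathcal{P}\subseteq y+\operatorname{recc}\mathcal{P}$. For $w\in\mathbb{R}^q$, the weighted sum scalarization (P$_w$) is $\min\{w^Tf(x) : x\in\mathcal{X}\}$; it is bounded if $\inf_{x\in\mathcal{X}}w^Tf(x)>-\infty$. Define $W:=\{w\in C^+ : (\mathrm{P}_w)\text{ is bounded}\}$. *)

theory Defs
  imports "HOL-Analysis.Analysis" "HOL-Library.Set_Algebras"
begin

(* Closed under strictly positive scaling only, so 0 need not be an element;
   this is weaker than the library's cone, conic and convex_cone. *)
definition pos_cone :: "'a::real_vector set \<Rightarrow> bool" where
  "pos_cone K \<longleftrightarrow> (\<forall>k\<in>K. \<forall>c>0. c *\<^sub>R k \<in> K)"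

definition pointed :: "'a::real_vector set \<Rightarrow> bool" where
  "pointed K \<longleftrightarrow> \<not> (\<exists>v. v \<noteq> 0 \<and> range (\<lambda>t::real. t *\<^sub>R v) \<subseteq> K)"

definition nontrivial_pointed_convex_cone :: "'a::real_vector set \<Rightarrow> bool" where
  "nontrivial_pointed_convex_cone K \<longleftrightarrow>
     pos_cone K \<and> convex K \<and> K \<noteq> {} \<and> K \<noteq> UNIV \<and> pointed K"

definition cone_le :: "'a::real_vector set \<Rightarrow> 'a \<Rightarrow> 'a \<Rightarrow> bool" where
  "cone_le C v w \<longleftrightarrow> w - v \<in> C"

(* Only the values of f on X matter. *)
definition cone_convex_on ::
    "'b::real_vector set \<Rightarrow> 'a::real_vector set \<Rightarrow> ('a \<Rightarrow> 'b) \<Rightarrow> bool" where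
  "cone_convex_on C X f \<longleftrightarrow>
     (\<forall>x\<in>X. \<forall>y\<in>X. \<forall>\<alpha>\<in>{0..1}.
        cone_le C (f (\<alpha> *\<^sub>R x + (1 - \<alpha>) *\<^sub>R y)) (\<alpha> *\<^sub>R f x + (1 - \<alpha>) *\<^sub>R f y))"

definition dual_cone :: "'a::real_inner set \<Rightarrow> 'a set" where
  "dual_cone K = {z. \<forall>y\<in>K. z \<bullet> y \<ge> 0}"

definition recc :: "'a::real_vector set \<Rightarrow> 'a set" where
  "recc A = {k. \<forall>a\<in>A. \<forall>\<alpha>\<ge>0. a + \<alpha> *\<^sub>R k \<in> A}"

definition feasible_set ::
    "'c::real_vector set \<Rightarrow> 'a set \<Rightarrow> ('a \<Rightarrow> 'c) \<Rightarrow> 'a set" where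
  "feasible_set D X g = {x \<in> X. cone_le D (g x) 0}"

definition upper_image ::
    "'b::real_normed_vector set \<Rightarrow> 'c::real_vector set \<Rightarrow> 'a set \<Rightarrow> ('a \<Rightarrow> 'b) \<Rightarrow> ('a \<Rightarrow> 'c) \<Rightarrow> 'b set"
  where
  "upper_image C D X f g = closure (f ` feasible_set D X g + C)"

definition self_bounded ::
    "'b::real_normed_vector set \<Rightarrow> 'c::real_vector set \<Rightarrow> 'a set \<Rightarrow> ('a \<Rightarrow> 'b) \<Rightarrow> ('a \<Rightarrow> 'c) \<Rightarrow> bool"
  where
  "self_bounded C D X f g \<longleftrightarrow>
     upper_image C D X f g \<noteq> UNIV \<and>
     (\<exists>y. upper_image C D X f g \<subseteq> (\<lambda>k. y + k) ` recc (upper_image C D X f g))"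

(* The infimum is taken in the extended reals; over real it would be junk for unbounded sets. *)
definition scalarization_bounded ::
    "'c::real_vector set \<Rightarrow> 'a set \<Rightarrow> ('a \<Rightarrow> 'b::real_inner) \<Rightarrow> ('a \<Rightarrow> 'c) \<Rightarrow> 'b \<Rightarrow> bool" where
  "scalarization_bounded D X f g w \<longleftrightarrow>
     (INF x\<in>feasible_set D X g. ereal (w \<bullet> f x)) > - \<infinity>"

definition bounded_weights ::
    "'b::real_inner set \<Rightarrow> 'c::real_vector set \<Rightarrow> 'a set \<Rightarrow> ('a \<Rightarrow> 'b) \<Rightarrow> ('a \<Rightarrow> 'c) \<Rightarrow> 'b set" where
  "bounded_weights C D X f g = {w \<in> dual_cone C. scalarization_bounded D X f g w}"

end

(*
  The set W is exactly the barrier cone of the closed convex set P, i.e. the set of all w that are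
  bounded below on P. Writing P as an intersection of half-spaces shows that recc P is the dual
  cone of W, so the first claim is the bipolar theorem for the convex cone W. If P is contained
  in y + recc P, then every w in the dual cone of recc P is bounded below on P by the value of w at y.
*)
theory Submission
  imports Defs
begin

text \<open>The negative of the classical barrier cone, which asks for upper bounds: here the sign
  matches the minimization in the scalarized problems. A real witness \<open>m\<close> replaces an
  infimum, so unbounded functionals cause no junk values.\<close>

definition barrier_cone :: "'a::real_inner set \<Rightarrow> 'a set" where
  "barrier_cone P = {w. \<exists>m. \<forall>p\<in>P. m \<le> w \<bullet> p}"

lemma zero_in_barrier_cone: "0 \<in> barrier_cone P"
  unfolding barrier_cone_def by auto

lemma scaleR_in_barrier_cone:
  assumes "w \<in> barrier_cone P" "c \<ge> 0"
  shows "c *\<^sub>R w \<in> barrier_cone P"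
proof -
  obtain m where "\<And>p. p \<in> P \<Longrightarrow> m \<le> w \<bullet> p"
    using assms(1) unfolding barrier_cone_def by auto
  then have "\<forall>p\<in>P. c * m \<le> (c *\<^sub>R w) \<bullet> p"
    using assms(2) by (auto intro: mult_left_mono)
  then show ?thesis unfolding barrier_cone_def by blast
qed

lemma add_in_barrier_cone:
  assumes "v \<in> barrier_cone P" "w \<in> barrier_cone P"
  shows "v + w \<in> barrier_cone P"
proof -
  obtain m n where "\<And>p. p \<in> P \<Longrightarrow> m \<le> v \<bullet> p" "\<And>p. p \<in> P \<Longrightarrow> n \<le> w \<bullet> p"
    using assms unfolding barrier_cone_def by auto
  then have "\<forall>p\<in>P. m + n \<le> (v + w) \<bullet> p"
    by (auto simp: inner_add_left intro: add_mono)
  then show ?thesis unfolding barrier_cone_def by blast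
qed

text \<open>A lower bound \<open>m\<close> on \<open>P\<close> places \<open>P\<close> in a closed
  half-space, which then contains the closure too. This removes the closure from the upper
  image.\<close>

lemma barrier_cone_closure: "barrier_cone (closure P) = barrier_cone P"
proof -
  have "\<forall>p\<in>closure P. m \<le> w \<bullet> p" if "\<forall>p\<in>P. m \<le> w \<bullet> p" for w m
    using closure_minimal[of P "{p. m \<le> w \<bullet> p}"] that
    by (auto simp: closed_halfspace_ge)
  then show ?thesis
    unfolding barrier_cone_def using closure_subset[of P] by blast
qed

text \<open>Along the ray, \<open>w\<close> is affine in \<open>t\<close> with slope
  \<open>w \<bullet> k\<close>, and a negative slope would eventually break the lower bound. A
  single ray with \<open>t > 0\<close> is enough, which suits cones closed only under strictly
  positive scaling.\<close>

lemma barrier_cone_nonneg_on_recession_direction: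
  assumes "w \<in> barrier_cone P" "a \<in> P" and ray: "\<And>t. t > 0 \<Longrightarrow> a + t *\<^sub>R k \<in> P"
  shows "w \<bullet> k \<ge> 0"
proof (rule ccontr)
  assume neg: "\<not> w \<bullet> k \<ge> 0"
  obtain m where m: "\<And>p. p \<in> P \<Longrightarrow> m \<le> w \<bullet> p"
    using assms(1) unfolding barrier_cone_def by auto
  \<comment> \<open>Chosen so that \<open>w\<close> takes the value \<open>m - 1\<close> at
    \<open>a + t *\<^sub>R k\<close>.\<close>
  define t where "t = (w \<bullet> a - m + 1) / - (w \<bullet> k)"
  have "t > 0" unfolding t_def using m[OF assms(2)] neg by (intro divide_pos_pos) auto
  moreover have "t * (w \<bullet> k) = - (w \<bullet> a - m + 1)" unfolding t_def using neg by simp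
  ultimately show False using m[OF ray, of t] by (simp add: inner_add_right)
qed

text \<open>If a ray from \<open>a\<close> in direction \<open>k\<close> left \<open>P\<close>, a
  hyperplane would strictly separate \<open>P\<close> from a point of the ray. Its normal is bounded
  below on \<open>P\<close>, hence nonnegative on \<open>k\<close>, so it cannot be smaller at that
  point than at \<open>a\<close>.\<close>

lemma recc_eq_dual_barrier_cone:
  fixes P :: "'a::euclidean_space set"
  assumes "closed P" "convex P" "P \<noteq> {}"
  shows "recc P = dual_cone (barrier_cone P)"
proof (intro subset_antisym subsetI)
  fix k assume k: "k \<in> recc P"
  obtain a where "a \<in> P" using assms(3) by auto
  then show "k \<in> dual_cone (barrier_cone P)"
    using barrier_cone_nonneg_on_recession_direction[of _ P a k] k
    unfolding recc_def dual_cone_def by (auto simp: inner_commute)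
next
  fix k assume k: "k \<in> dual_cone (barrier_cone P)"
  show "k \<in> recc P"
    unfolding recc_def
  proof (intro CollectI ballI allI impI, rule ccontr)
    fix a and t :: real assume a: "a \<in> P" and t: "t \<ge> 0" and out: "a + t *\<^sub>R k \<notin> P"
    obtain w b where w: "w \<bullet> (a + t *\<^sub>R k) < b" "\<forall>p\<in>P. w \<bullet> p > b"
      using separating_hyperplane_closed_point[OF assms(2,1) out] by auto
    then have "w \<in> barrier_cone P" unfolding barrier_cone_def using less_imp_le by blast
    then have "k \<bullet> w \<ge> 0" using k unfolding dual_cone_def by auto
    then have "t * (w \<bullet> k) \<ge> 0" using t by (simp add: inner_commute)
    moreover have "w \<bullet> a > b" using w(2) a by blast
    ultimately show False using w(1) by (simp add: inner_add_right)
  qed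
qed

text \<open>The bipolar theorem for a convex cone \<open>B\<close> containing 0. A normal
  \<open>y\<close> separating \<open>z\<close> from the closure lies in the dual cone, yet is
  negative at \<open>z\<close>.\<close>

lemma dual_dual_cone_eq_closure:
  fixes B :: "'a::euclidean_space set"
  assumes "0 \<in> B" and scale: "\<And>w c. w \<in> B \<Longrightarrow> c \<ge> 0 \<Longrightarrow> c *\<^sub>R w \<in> B"
    and add: "\<And>v w. v \<in> B \<Longrightarrow> w \<in> B \<Longrightarrow> v + w \<in> B"
  shows "dual_cone (dual_cone B) = closure B"
proof (intro subset_antisym subsetI)
  fix z assume z: "z \<in> dual_cone (dual_cone B)"
  show "z \<in> closure B"
  proof (rule ccontr)
    assume out: "z \<notin> closure B"
    have "convex B" unfolding convex_def using scale add by auto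
    then obtain y b where y: "y \<bullet> z < b" "\<forall>w\<in>closure B. y \<bullet> w > b"
      using separating_hyperplane_closed_point[OF convex_closure closed_closure out] by auto
    have B: "y \<bullet> w > b" if "w \<in> B" for w using y(2) that closure_subset[of B] by blast
    \<comment> \<open>On a cone, boundedness below already means nonnegativity: each
      \<open>w\<close> in \<open>B\<close> is a recession direction starting at \<open>w\<close>
      itself.\<close>
    have "y \<bullet> w \<ge> 0" if "w \<in> B" for w
    proof (rule barrier_cone_nonneg_on_recession_direction)
      show "y \<in> barrier_cone B" unfolding barrier_cone_def using B less_imp_le by blast
      show "w + t *\<^sub>R w \<in> B" if "t > 0" for t using add scale \<open>w \<in> B\<close> that by simp
    qed fact
    then have "y \<in> dual_cone B" unfolding dual_cone_def by auto
    then have "y \<bullet> z \<ge> 0" using z unfolding dual_cone_def by (auto simp: inner_commute)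
    moreover have "b < 0" using B[OF assms(1)] by simp
    ultimately show False using y(1) by simp
  qed
next
  fix z assume z: "z \<in> closure B"
  have "y \<bullet> z \<ge> 0" if "y \<in> dual_cone B" for y
    using closure_minimal[of B "{w. y \<bullet> w \<ge> 0}"] that z
    unfolding dual_cone_def by (auto simp: closed_halfspace_ge)
  then show "z \<in> dual_cone (dual_cone B)"
    unfolding dual_cone_def by (auto simp: inner_commute)
qed

lemma dual_recc_eq_closure_barrier_cone:
  fixes P :: "'a::euclidean_space set"
  assumes "closed P" "convex P" "P \<noteq> {}"
  shows "dual_cone (recc P) = closure (barrier_cone P)"
  unfolding recc_eq_dual_barrier_cone[OF assms]
  by (intro dual_dual_cone_eq_closure zero_in_barrier_cone scaleR_in_barrier_cone
      add_in_barrier_cone)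

text \<open>The value at the apex \<open>y\<close> is itself a lower bound on \<open>P\<close>, so
  membership holds without passing to a closure.\<close>

lemma dual_recc_subset_barrier_cone:
  assumes "P \<subseteq> (\<lambda>k. y + k) ` recc P"
  shows "dual_cone (recc P) \<subseteq> barrier_cone P"
proof
  fix w assume "w \<in> dual_cone (recc P)"
  then have "\<forall>p\<in>P. w \<bullet> y \<le> w \<bullet> p"
    using assms unfolding dual_cone_def by (fastforce simp: inner_add_right)
  then show "w \<in> barrier_cone P" unfolding barrier_cone_def by blast
qed

text \<open>The sum is the midpoint of the scaled points \<open>2 *\<^sub>R u\<close> and
  \<open>2 *\<^sub>R v\<close>.\<close>

lemma convex_pos_cone_add:
  assumes "pos_cone K" "convex K" "u \<in> K" "v \<in> K"
  shows "u + v \<in> K"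
proof -
  have "(1/2) *\<^sub>R (2 *\<^sub>R u) + (1/2) *\<^sub>R (2 *\<^sub>R v) \<in> K"
    using assms unfolding pos_cone_def by (intro convexD) auto
  then show ?thesis by simp
qed

text \<open>\<open>pos_cone\<close> does not supply 0, but the convexity inequality with both points
  equal to \<open>x\<close> forces \<open>h x\<close> to be related to itself.\<close>

lemma cone_convex_on_zero_mem:
  assumes "cone_convex_on K X h" "x \<in> X"
  shows "0 \<in> K"
proof -
  have "cone_le K (h ((1::real) *\<^sub>R x + (1 - 1) *\<^sub>R x)) ((1::real) *\<^sub>R h x + (1 - 1) *\<^sub>R h x)"
    using assms unfolding cone_convex_on_def by (metis atLeastAtMost_iff order_refl zero_le_one)
  then show ?thesis unfolding cone_le_def by simp
qed

lemma convex_feasible_set: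
  assumes "pos_cone D" "convex D" "convex X" "cone_convex_on D X g"
  shows "convex (feasible_set D X g)"
  unfolding convex_def
proof (intro ballI allI impI)
  fix x y and u v :: real
  assume x: "x \<in> feasible_set D X g" and y: "y \<in> feasible_set D X g"
    and uv: "0 \<le> u" "0 \<le> v" "u + v = 1"
  have X: "x \<in> X" "y \<in> X" and g: "- g x \<in> D" "- g y \<in> D"
    using x y unfolding feasible_set_def cone_le_def by auto
  \<comment> \<open>The convexity gap of \<open>g\<close>, from the instance \<alpha> =
    \<open>u\<close>, where \<open>1 - u = v\<close>. Adding the combination of \<open>- g x\<close>
    and \<open>- g y\<close> below leaves minus the value of \<open>g\<close> at the combined
    point.\<close>
  have "(u *\<^sub>R g x + v *\<^sub>R g y) - g (u *\<^sub>R x + v *\<^sub>R y) \<in> D"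
    using assms(4) X uv unfolding cone_convex_on_def cone_le_def
    by (metis add_diff_cancel_left' atLeastAtMost_iff le_add_same_cancel1)
  moreover have "u *\<^sub>R (- g x) + v *\<^sub>R (- g y) \<in> D"
    using convexD[OF assms(2) g uv] .
  ultimately have "((u *\<^sub>R g x + v *\<^sub>R g y) - g (u *\<^sub>R x + v *\<^sub>R y))
      + (u *\<^sub>R (- g x) + v *\<^sub>R (- g y)) \<in> D"
    by (rule convex_pos_cone_add[OF assms(1,2)])
  then show "u *\<^sub>R x + v *\<^sub>R y \<in> feasible_set D X g"
    using convexD[OF assms(3) X uv] unfolding feasible_set_def cone_le_def by simp
qed

text \<open>The image of \<open>S\<close> alone may fail to be convex; the convexity gap of
  \<open>f\<close> lies in \<open>C\<close> and is absorbed by the summand \<open>C\<close>.\<close>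

lemma convex_image_plus_cone:
  assumes "pos_cone C" "convex C" "convex S" "S \<subseteq> X" "cone_convex_on C X f"
  shows "convex (f ` S + C)"
  unfolding convex_def
proof (intro ballI allI impI)
  fix p q and u v :: real
  assume p: "p \<in> f ` S + C" and q: "q \<in> f ` S + C" and uv: "0 \<le> u" "0 \<le> v" "u + v = 1"
  obtain x c where x: "x \<in> S" "c \<in> C" "p = f x + c" using p by (auto elim!: set_plus_elim)
  obtain y d where y: "y \<in> S" "d \<in> C" "q = f y + d" using q by (auto elim!: set_plus_elim)
  define z where "z = u *\<^sub>R x + v *\<^sub>R y"
  have z: "z \<in> S" unfolding z_def using convexD[OF assms(3) x(1) y(1) uv] .
  have "x \<in> X" "y \<in> X" using x y assms(4) by auto
  then have "(u *\<^sub>R f x + v *\<^sub>R f y) - f z \<in> C"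
    using assms(5) uv unfolding cone_convex_on_def cone_le_def z_def
    by (metis add_diff_cancel_left' atLeastAtMost_iff le_add_same_cancel1)
  moreover have "u *\<^sub>R c + v *\<^sub>R d \<in> C" using convexD[OF assms(2) x(2) y(2) uv] .
  ultimately have "((u *\<^sub>R f x + v *\<^sub>R f y) - f z) + (u *\<^sub>R c + v *\<^sub>R d) \<in> C"
    by (rule convex_pos_cone_add[OF assms(1,2)])
  then have "f z + (((u *\<^sub>R f x + v *\<^sub>R f y) - f z) + (u *\<^sub>R c + v *\<^sub>R d)) \<in> f ` S + C"
    using z by (intro set_plus_intro) auto
  then show "u *\<^sub>R p + v *\<^sub>R q \<in> f ` S + C"
    unfolding x y by (simp add: algebra_simps)
qed

lemma scalarization_bounded_iff:
  "scalarization_bounded D X f g w \<longleftrightarrow> w \<in> barrier_cone (f ` feasible_set D X g)"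
proof
  assume "scalarization_bounded D X f g w"
  \<comment> \<open>Density yields a real number strictly between minus infinity and the infimum,
    even when the infimum is plus infinity.\<close>
  then obtain m where "ereal m < (INF x\<in>feasible_set D X g. ereal (w \<bullet> f x))"
    unfolding scalarization_bounded_def using ereal_dense2 by blast
  then have "\<forall>x\<in>feasible_set D X g. m \<le> w \<bullet> f x"
    using less_INF_D by fastforce
  then show "w \<in> barrier_cone (f ` feasible_set D X g)" unfolding barrier_cone_def by blast
next
  assume "w \<in> barrier_cone (f ` feasible_set D X g)"
  then obtain m where "\<forall>x\<in>feasible_set D X g. m \<le> w \<bullet> f x"
    unfolding barrier_cone_def by auto
  then have "ereal m \<le> (INF x\<in>feasible_set D X g. ereal (w \<bullet> f x))"
    by (intro INF_greatest) auto
  then show "scalarization_bounded D X f g w"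
    unfolding scalarization_bounded_def by (auto intro: less_le_trans[of _ "ereal m"])
qed

text \<open>Rays from a point of \<open>S\<close> in the directions of \<open>C\<close> stay in
  \<open>S + C\<close>, which forces \<open>w\<close> into the dual cone; \<open>0 \<in> C\<close>
  keeps \<open>S\<close> inside the sum. Conversely, adding an element of \<open>C\<close> never
  lowers \<open>w\<close>.\<close>

lemma barrier_cone_plus_cone:
  assumes "pos_cone C" "0 \<in> C" "S \<noteq> {}"
  shows "barrier_cone (S + C) = dual_cone C \<inter> barrier_cone S"
proof (intro subset_antisym subsetI IntI)
  fix w assume w: "w \<in> barrier_cone (S + C)"
  have "S \<subseteq> S + C" using set_plus_intro[of _ S 0 C] assms(2) by auto
  then show "w \<in> barrier_cone S" using w unfolding barrier_cone_def by blast
  obtain s where s: "s \<in> S" using assms(3) by auto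
  have "w \<bullet> c \<ge> 0" if "c \<in> C" for c
  proof (rule barrier_cone_nonneg_on_recession_direction[OF w])
    show "s \<in> S + C" using s \<open>S \<subseteq> S + C\<close> by auto
    show "s + t *\<^sub>R c \<in> S + C" if "t > 0" for t
      using assms(1) s \<open>c \<in> C\<close> that unfolding pos_cone_def by (intro set_plus_intro) auto
  qed
  then show "w \<in> dual_cone C" unfolding dual_cone_def by auto
next
  fix w assume w: "w \<in> dual_cone C \<inter> barrier_cone S"
  then obtain m where m: "\<And>s. s \<in> S \<Longrightarrow> m \<le> w \<bullet> s" unfolding barrier_cone_def by auto
  have "m \<le> w \<bullet> p" if p: "p \<in> S + C" for p
  proof -
    obtain s c where sc: "s \<in> S" "c \<in> C" "p = s + c" using p by (auto elim!: set_plus_elim)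
    have "w \<bullet> c \<ge> 0" using w sc(2) unfolding dual_cone_def by auto
    then show ?thesis using m[OF sc(1)] unfolding sc(3) by (simp add: inner_add_right)
  qed
  then show "w \<in> barrier_cone (S + C)" unfolding barrier_cone_def by blast
qed

text \<open>Both conditions defining the weights, dual cone membership and boundedness of the
  scalarization, are encoded together in a lower bound on the image plus \<open>C\<close>.\<close>

lemma bounded_weights_eq_barrier_cone:
  assumes "pos_cone C" "0 \<in> C" "feasible_set D X g \<noteq> {}"
  shows "bounded_weights C D X f g = barrier_cone (upper_image C D X f g)"
proof -
  have "barrier_cone (upper_image C D X f g) = dual_cone C \<inter> barrier_cone (f ` feasible_set D X g)"
    unfolding upper_image_def barrier_cone_closure
    using assms by (intro barrier_cone_plus_cone) auto
  then show ?thesis unfolding bounded_weights_def scalarization_bounded_iff by auto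
qed

theorem proposition4p12:
  fixes C :: "(real ^ 'q) set" and D :: "(real ^ 'm) set" and X :: "(real ^ 'n) set"
    and f :: "real ^ 'n \<Rightarrow> real ^ 'q" and g :: "real ^ 'n \<Rightarrow> real ^ 'm"
  assumes "nontrivial_pointed_convex_cone C" and "interior C \<noteq> {}"
    and "nontrivial_pointed_convex_cone D" and "interior D \<noteq> {}"
    and "convex X"
    and "cone_convex_on C X f"
    and "cone_convex_on D X g"
    and "feasible_set D X g \<noteq> {}"
  shows "dual_cone (recc (upper_image C D X f g)) = closure (bounded_weights C D X f g)
    \<and> (self_bounded C D X f g \<longrightarrow>
         dual_cone (recc (upper_image C D X f g)) = bounded_weights C D X f g)"
proof -
  let ?P = "upper_image C D X f g" and ?S = "feasible_set D X g"
  have C: "pos_cone C" "convex C" and D: "pos_cone D" "convex D"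
    using assms(1,3) unfolding nontrivial_pointed_convex_cone_def by auto
  have SX: "?S \<subseteq> X" unfolding feasible_set_def by auto
  then have C0: "0 \<in> C" using cone_convex_on_zero_mem[OF assms(6)] assms(8) by blast
  have W: "bounded_weights C D X f g = barrier_cone ?P"
    using bounded_weights_eq_barrier_cone[OF C(1) C0 assms(8)] .
  have "convex (f ` ?S + C)"
    using convex_image_plus_cone[OF C convex_feasible_set[OF D assms(5,7)] SX assms(6)] .
  then have "convex ?P" unfolding upper_image_def by (rule convex_closure)
  moreover have "closed ?P" unfolding upper_image_def by simp
  moreover have "f ` ?S + C \<noteq> {}" using assms(8) C0 by (auto simp: set_plus_def)
  then have "?P \<noteq> {}" unfolding upper_image_def by simp
  ultimately have eq: "dual_cone (recc ?P) = closure (barrier_cone ?P)"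
    by (intro dual_recc_eq_closure_barrier_cone)
  \<comment> \<open>Self-boundedness puts the dual cone inside the barrier cone; the reverse
    inclusion follows from \<open>eq\<close>, as a set lies in its closure.\<close>
  have "dual_cone (recc ?P) = barrier_cone ?P" if "self_bounded C D X f g"
    using that dual_recc_subset_barrier_cone[of ?P] eq closure_subset[of "barrier_cone ?P"]
    unfolding self_bounded_def by blast
  with eq show ?thesis unfolding W by blast
qed

end
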